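(* For all $n \geq 1$, $\mathrm{psp}(n) \equiv z(n-1) + 1 \pmod 2$.
   Context: The paper-folding sequence $\{z(n)\}_{n\ge0}$ (OEIS A014707) is defined for $n\ge0$ by $z(4n)=0$, $z(4n+2)=1$, and $z(2n+1)=z(n)$. For $n\ge1$, $\mathrm{psp}(n)$ denotes the total number of parts (counted with multiplicity) in all the partitions in $\mathcal{SP}(n)$, the set of semi-Pell partitions of $n$, defined as follows. A partition of $n$ is a weakly decreasing sequence $\lambda_1\ge\lambda_2\ge\cdots$ (equivalently, a finite multiset) of positive integers with sum $n$. $\lambda\sqcup\mu$ is the partition whose multiset of parts is the multiset union (multiplicities added) of the parts of $\lambda$ and $\mu$; $2\lambda$ is obtained by doubling every part; $\mathrm{add}_{1,1}(\lambda)=(\lambda_1+1,\lambda_2,\ldots)$ is obtained by adding $1$ to the first (largest) part. These operations are applied elementwise to sets of partitions. Then $\mathcal{SP}(0)=\emptyset$, $\mathcal{SP}(1)=\{(1)\}$, and for $n\ge1$: $\mathcal{SP}(2n)=2\,\mathcal{SP}(n)$ and $\mathcal{SP}(2n+1)=\mathrm{add}_{1,1}(\mathcal{SP}(2n))\cup\big(\mathcal{SP}(2n)\sqcup(1)\big)\cup\big(\mathcal{SP}(2n-1)\sqcup(1,1)\big)$. *)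

theory Defs
  imports "HOL-Library.Multiset" "HOL-Number_Theory.Cong"
begin

function paperfolding :: "nat \<Rightarrow> nat" where
  "paperfolding (4 * n) = 0"
| "paperfolding (4 * n + 2) = 1"
| "paperfolding (2 * n + 1) = paperfolding n"
proof -
  fix P :: bool and x :: nat
  assume 1: "\<And>n. x = 4 * n \<Longrightarrow> P" and 2: "\<And>n. x = 4 * n + 2 \<Longrightarrow> P"
    and 3: "\<And>n. x = 2 * n + 1 \<Longrightarrow> P"
  have "x = 4 * (x div 4) \<or> x = 4 * (x div 4) + 2 \<or> x = 2 * (x div 2) + 1"
    by presburger
  with 1 2 3 show P by blast
qed (simp_all, presburger+)
termination by (relation "measure id") auto

text \<open>Partitions are represented by the finite multisets of their parts.\<close>

definition double :: "nat multiset \<Rightarrow> nat multiset" where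
  "double p = image_mset (\<lambda>k. 2 * k) p"

text \<open>The maximum of the empty multiset is unspecified, so \<open>add11\<close> is meaningful for nonempty
  partitions only.\<close>

definition add11 :: "nat multiset \<Rightarrow> nat multiset" where
  "add11 p = add_mset (Max_mset p + 1) (p - {#Max_mset p#})"

function SP :: "nat \<Rightarrow> nat multiset set" where
  "SP 0 = {}"
| "SP 1 = {{#1#}}"
| "n \<ge> 1 \<Longrightarrow> SP (2 * n) = double ` SP n"
| "n \<ge> 1 \<Longrightarrow> SP (2 * n + 1) =
     add11 ` SP (2 * n) \<union> (\<lambda>p. p + {#1#}) ` SP (2 * n) \<union> (\<lambda>p. p + {#1, 1#}) ` SP (2 * n - 1)"
proof -
  fix P :: bool and x :: nat
  assume 1: "x = 0 \<Longrightarrow> P" and 2: "x = 1 \<Longrightarrow> P"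
    and 3: "\<And>n. n \<ge> 1 \<Longrightarrow> x = 2 * n \<Longrightarrow> P"
    and 4: "\<And>n. n \<ge> 1 \<Longrightarrow> x = 2 * n + 1 \<Longrightarrow> P"
  have "x = 0 \<or> x = 1 \<or> (x div 2 \<ge> 1 \<and> x = 2 * (x div 2)) \<or> (x div 2 \<ge> 1 \<and> x = 2 * (x div 2) + 1)"
    by presburger
  with 1 2 3 4 show P by blast
qed (simp_all, presburger+)
termination by (relation "measure id") auto

lemma finite_SP: "finite (SP n)"
  by (induction n rule: SP.induct) (auto simp del: One_nat_def)

lemma sum_mset_double: "sum_mset (double q) = 2 * sum_mset q"
  by (induction q) (simp_all add: double_def)

lemma sum_mset_add11:
  assumes "q \<noteq> {#}"
  shows "sum_mset (add11 q) = sum_mset q + 1"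
proof -
  have "Max_mset q \<in># q" using assms by simp
  then have "sum_mset q = Max_mset q + sum_mset (q - {#Max_mset q#})"
    by (simp add: sum_mset.remove)
  then show ?thesis by (simp add: add11_def)
qed

lemma SP_is_partition: "p \<in> SP n \<Longrightarrow> p \<noteq> {#} \<and> 0 \<notin># p \<and> sum_mset p = n"
proof (induction n arbitrary: p rule: SP.induct)
  case 1
  then show ?case by simp
next
  case 2
  then show ?case by (simp only: SP.simps) simp
next
  case (3 n)
  from 3(3) obtain q where q: "q \<in> SP n" "p = double q" unfolding SP.simps(3)[OF 3(1)] by blast
  from 3(2)[OF q(1)] q(2) show ?case by (auto simp: sum_mset_double) (auto simp: double_def)
next
  case (4 n)
  have even: "q \<noteq> {#} \<and> 0 \<notin># q \<and> sum_mset q = 2 * n" if "q \<in> SP (2 * n)" for q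
    using that by (rule 4)
  have odd: "q \<noteq> {#} \<and> 0 \<notin># q \<and> sum_mset q = 2 * n - 1" if "q \<in> SP (2 * n - 1)" for q
    using that by (rule 4)
  from 4(5) consider q where "q \<in> SP (2 * n)" "p = add11 q"
    | q where "q \<in> SP (2 * n)" "p = q + {#1#}"
    | q where "q \<in> SP (2 * n - 1)" "p = q + {#1, 1#}"
    unfolding SP.simps(4)[OF 4(1)] by blast
  then show ?case
  proof cases
    case 1
    then show ?thesis
      using even[OF 1(1)] by (simp add: sum_mset_add11) (auto simp: add11_def dest: in_diffD)
  next
    case 2
    then show ?thesis using even[OF 2(1)] by simp
  next
    case 3
    then show ?thesis using odd[OF 3(1)] 4(1) by simp
  qed
qed

definition psp :: "nat \<Rightarrow> nat" where
  "psp n = (\<Sum>p\<in>SP n. size p)"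

end

theory Submission
  imports Defs
begin

text \<open>
  Modulo 2 the defining recursion of the semi-Pell partitions collapses. The three families that
  make up \<^term>\<open>SP (2 * n + 1)\<close> are told apart by their number of parts equal to 1, which is 0, 1
  and at least 2 respectively, and each of the operations involved is injective. Sums over
  \<^term>\<open>SP (2 * n + 1)\<close> therefore split into three sums over earlier sets
  (\<open>sum_SP_odd\<close>). Counting partitions this way gives
  \<open>|SP(2n+1)| = 2 |SP(2n)| + |SP(2n-1)|\<close>, so every \<open>|SP(n)|\<close> with \<open>n \<ge> 1\<close> is odd.
  Counting parts gives
  \<open>psp(2n+1) = 2 psp(2n) + |SP(2n)| + psp(2n-1) + 2 |SP(2n-1)|\<close>, which has the parity of
  \<open>psp(2n-1) + 1\<close>. Since \<open>psp(1) = 1\<close>, the parity of \<open>psp\<close> alternates along the odd numbers,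
  just as the paper-folding sequence alternates along the even numbers. The remaining recursions
  \<open>psp(2n) = psp(n)\<close> and \<open>z(2n-1) = z(n-1)\<close> match as well.
\<close>

lemma inj_double: "inj double"
proof -
  have "inj (image_mset (\<lambda>k::nat. 2 * k))"
    by (rule multiset.inj_map) (simp add: inj_def)
  then show ?thesis by (simp add: inj_def double_def)
qed

lemma size_double [simp]: "size (double p) = size p"
  by (simp add: double_def)

lemma size_add11 [simp]: "p \<noteq> {#} \<Longrightarrow> size (add11 p) = size p"
  by (simp add: add11_def size_Diff_singleton nonempty_has_size)

lemma Max_add11: "p \<noteq> {#} \<Longrightarrow> Max_mset (add11 p) = Max_mset p + 1"
  unfolding add11_def by (rule Max_eqI) (auto dest!: in_diffD Max_ge[rotated] intro: le_SucI)

text \<open>The increased part is still the largest one, so it can be found and decreased again.\<close>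

lemma inj_on_add11: "inj_on add11 {p. p \<noteq> {#}}"
proof (rule inj_onI)
  fix p q assume pq: "p \<in> {p. p \<noteq> {#}}" "q \<in> {p. p \<noteq> {#}}" and eq: "add11 p = add11 q"
  then have M: "Max_mset p = Max_mset q"
    using Max_add11[of p] Max_add11[of q] by simp
  with eq have "p - {#Max_mset p#} = q - {#Max_mset p#}"
    by (simp add: add11_def)
  moreover have "Max_mset p \<in># p" using pq by simp
  moreover have "Max_mset p \<in># q" unfolding M using pq by simp
  ultimately show "p = q" by (metis insert_DiffM)
qed

lemma count_1_SP_even: "n \<ge> 1 \<Longrightarrow> p \<in> SP (2 * n) \<Longrightarrow> count p 1 = 0"
  by (auto simp: SP.simps(3) double_def count_eq_zero_iff)

lemma count_1_add11_SP_even: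
  assumes "n \<ge> 1" "p \<in> SP (2 * n)"
  shows "count (add11 p) 1 = 0"
proof -
  have "Max_mset p \<in># p" "0 \<notin># p" using SP_is_partition[OF assms(2)] by auto
  then have "Max_mset p \<noteq> 0" by metis
  then show ?thesis
    using count_1_SP_even[OF assms] by (simp add: add11_def)
qed

lemma sum_SP_even:
  "n \<ge> 1 \<Longrightarrow> (\<Sum>p\<in>SP (2 * n). f p) = (\<Sum>p\<in>SP n. f (double p))"
  by (simp only: SP.simps(3)) (simp add: sum.reindex inj_on_subset[OF inj_double])

text \<open>The union in the recursion for odd arguments is a disjoint union of injective images; the
  number of parts equal to 1 separates its three members.\<close>

lemma sum_SP_odd:
  fixes f :: "nat multiset \<Rightarrow> 'a :: comm_monoid_add"
  assumes n: "n \<ge> 1"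
  shows "(\<Sum>p\<in>SP (2 * n + 1). f p) =
    (\<Sum>p\<in>SP (2 * n). f (add11 p)) + (\<Sum>p\<in>SP (2 * n). f (p + {#1#}))
      + (\<Sum>p\<in>SP (2 * n - 1). f (p + {#1, 1#}))"
proof -
  let ?A = "add11 ` SP (2 * n)"
  let ?B = "(\<lambda>p. p + {#1#}) ` SP (2 * n)"
  let ?C = "(\<lambda>p. p + {#1, 1#}) ` SP (2 * n - 1)"
  have A: "count p 1 = 0" if "p \<in> ?A" for p
    using that by (auto simp only: count_1_add11_SP_even[OF n])
  have B: "count p 1 = 1" if "p \<in> ?B" for p
    using that count_1_SP_even[OF n] by auto
  have C: "count p 1 \<ge> 2" if "p \<in> ?C" for p
    using that by auto
  have AB: "?A \<inter> ?B = {}" using A B by fastforce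
  have ABC: "(?A \<union> ?B) \<inter> ?C = {}" using A B C by fastforce
  have "inj_on add11 (SP (2 * n))"
    by (rule inj_on_subset[OF inj_on_add11]) (auto dest: SP_is_partition)
  then have sA: "sum f ?A = (\<Sum>p\<in>SP (2 * n). f (add11 p))"
    by (simp add: sum.reindex)
  have sB: "sum f ?B = (\<Sum>p\<in>SP (2 * n). f (p + {#1#}))"
    by (subst sum.reindex) (auto simp: inj_on_def)
  have sC: "sum f ?C = (\<Sum>p\<in>SP (2 * n - 1). f (p + {#1, 1#}))"
    by (subst sum.reindex) (auto simp: inj_on_def)
  have "sum f (SP (2 * n + 1)) = sum f (?A \<union> ?B \<union> ?C)"
    by (simp only: SP.simps(4)[OF n])
  also have "\<dots> = sum f (?A \<union> ?B) + sum f ?C"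
    by (rule sum.union_disjoint) (use ABC finite_SP in auto)
  also have "sum f (?A \<union> ?B) = sum f ?A + sum f ?B"
    by (rule sum.union_disjoint) (use AB finite_SP in auto)
  finally show ?thesis by (simp only: sA sB sC)
qed

lemma card_SP_even: "n \<ge> 1 \<Longrightarrow> card (SP (2 * n)) = card (SP n)"
  using sum_SP_even[of n "\<lambda>_. 1 :: nat"] by simp

lemma card_SP_odd:
  "n \<ge> 1 \<Longrightarrow> card (SP (2 * n + 1)) = 2 * card (SP (2 * n)) + card (SP (2 * n - 1))"
  using sum_SP_odd[of n "\<lambda>_. 1 :: nat"] by simp

lemma odd_card_SP: "n \<ge> 1 \<Longrightarrow> odd (card (SP n))"
proof (induction n rule: SP.induct)
  case 1
  then show ?case by simp
next
  case 2
  show ?case by (simp only: SP.simps) simp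
next
  case (3 n)
  then show ?case unfolding card_SP_even[OF 3(1)] by simp
next
  case (4 n)
  then have "odd (card (SP (2 * n - 1)))" by simp
  then show ?case unfolding card_SP_odd[OF 4(1)] by simp
qed

lemma psp_even: "n \<ge> 1 \<Longrightarrow> psp (2 * n) = psp n"
  by (simp only: psp_def sum_SP_even size_double)

lemma psp_odd:
  assumes "n \<ge> 1"
  shows "psp (2 * n + 1) =
    2 * psp (2 * n) + card (SP (2 * n)) + psp (2 * n - 1) + 2 * card (SP (2 * n - 1))"
proof -
  have "(\<Sum>p\<in>SP (2 * n). size (add11 p)) = psp (2 * n)"
    unfolding psp_def by (rule sum.cong) (auto dest: SP_is_partition)
  then show ?thesis
    unfolding psp_def sum_SP_odd[OF assms] by (simp add: sum.distrib sum_Suc)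
qed

lemma even_psp_odd_iff: "even (psp (2 * n + 1)) \<longleftrightarrow> odd n"
proof (induction n)
  case 0
  have "psp 1 = 1" by (simp only: psp_def SP.simps) simp
  then show ?case by simp
next
  case (Suc n)
  have "2 * Suc n - 1 = 2 * n + 1" by simp
  then show ?case
    using psp_odd[of "Suc n"] odd_card_SP[of "2 * Suc n"] Suc by simp
qed

lemma paperfolding_even: "paperfolding (2 * n) = n mod 2"
proof (cases "even n")
  case True
  then obtain k where "n = 2 * k" by blast
  then show ?thesis using paperfolding.simps(1)[of k] by simp
next
  case False
  then obtain k where "n = 2 * k + 1" by (rule oddE)
  then show ?thesis using paperfolding.simps(2)[of k] by simp
qed

theorem theorem6p4:
  fixes n :: nat
  assumes "n \<ge> 1"
  shows "[psp n = paperfolding (n - 1) + 1] (mod 2)"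
  using assms
proof (induction n rule: less_induct)
  case (less n)
  show ?case
  proof (cases "even n")
    case True
    then obtain m where m: "n = 2 * m" by blast
    with less.prems have "m \<ge> 1" "m < n" by auto
    moreover have "n - 1 = 2 * (m - 1) + 1" using m \<open>m \<ge> 1\<close> by simp
    then have "paperfolding (n - 1) = paperfolding (m - 1)"
      by (simp only: paperfolding.simps(3))
    ultimately show ?thesis
      using less.IH[of m] psp_even[of m] m by simp
  next
    case False
    then obtain m where m: "n = 2 * m + 1" by (rule oddE)
    then have "even (psp n) \<longleftrightarrow> even (m mod 2 + 1)"
      using even_psp_odd_iff[of m] by (simp add: even_mod_2_iff)
    then show ?thesis
      using m by (simp add: paperfolding_even cong_def mod2_eq_if)
  qed
qed

end
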